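(* Consider the equation $\partial_t u = Lu + N(u)u$ on a spatial domain $\Omega$, and its discretization by the linearly implicit method with time step $h>0$ described in the context. Assume $L=i\Delta$ and $N$ takes values in $i\mathbb{R}$. Assume the underlying $s$-stage collocation Runge--Kutta method $(A,b,c)$ satisfies the Cooper condition $$\forall\, 1\leq i,j\leq s,\qquad b_ib_j-b_ia_{ij}-b_ja_{ji}=0.$$ Assume the eigenvalues of $D$ are chosen so that $D$ is a real-valued square matrix and $\Theta$ is a real-valued vector. If $\gamma_{-1,1},\dots,\gamma_{-1,s}$ take values in $i\mathbb{R}$, then for all $u_0\in L^2(\Omega)$ and for all $n\in\mathbb{N}$ such that $u_n$ is well-defined by the linearly implicit method, one has $$\|u_n\|^2=\|u_0\|^2,$$ where $\|\cdot\|$ is the $L^2(\Omega)$-norm.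
   Context: Setting. The equation is a nonlinear Schrödinger equation $\partial_t u=Lu+N(u)u$ with $L=i\Delta$ (with appropriate boundary conditions on $\Omega$) and $N$ taking values in $i\mathbb{R}$, such that the associated Cauchy problem is well-posed. The unknown $u$ is complex-valued. Collocation method. An $s$-stage Runge--Kutta method with real coefficients $A=(a_{ij})$, $b=(b_i)$, $c=(c_i)$ is of collocation if $c_1,\dots,c_s$ are distinct real numbers and, with $\ell_i(\tau)=\prod_{j\neq i}\frac{\tau-c_j}{c_i-c_j}$, one has $a_{ij}=\int_0^{c_i}\ell_j(\tau)\,d\tau$ and $b_i=\int_0^1\ell_i(\tau)\,d\tau$. Linearly implicit method, with time step $h>0$, $s\times s$ matrix $D$ and vector $\Theta=(\theta_1,\dots,\theta_s)^t$. Starting from $u_0$ and functions $\Gamma_{-1}=(\gamma_{-1,1},\dots,\gamma_{-1,s})^t$ on $\Omega$, for $k\geq 0$: (1) $\Gamma_k=(\gamma_{k,1},\dots,\gamma_{k,s})^t=D\Gamma_{k-1}+\Theta N(u_k)$, pointwise in space; (2) $(u_{k,i})_{1\leq i\leq s}$ solves the linear system $u_{k,i}=u_k+h\sum_{j=1}^sa_{ij}(L+\gamma_{k,j})u_{k,j}$, $1\leq i\leq s$; (3) $u_{k+1}=u_k+h\sum_{i=1}^sb_i(L+\gamma_{k,i})u_{k,i}$. Here $\gamma_{k,j}u_{k,j}$ is the pointwise product. Standing assumption on step (1): the spectral radius of $D$ is strictly less than $1$, and $V_c=DV_{c-1}+\vartheta$, where $(V_c)_{i,j}=c_i^{j-1}$,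 $(V_{c-1})_{i,j}=(c_i-1)^{j-1}$, and $\vartheta$ is the $s\times s$ matrix with first column $\Theta$ and zeros elsewhere. *)

theory Defs
  imports "HOL-Analysis.Analysis" "Jordan_Normal_Form.Spectral_Radius"
begin

unbundle no vec_syntax

section \<open>Square-integrable functions\<close>

text \<open>Elements of \<open>L\<^sup>2(\<Omega>)\<close> are handled through representatives; identities between them are
  stated almost everywhere.\<close>

definition L2 :: "'a::euclidean_space set \<Rightarrow> ('a \<Rightarrow> complex) set" where
  "L2 \<Omega> = {f. f \<in> borel_measurable (lebesgue_on \<Omega>) \<and>
              integrable (lebesgue_on \<Omega>) (\<lambda>x. (cmod (f x))\<^sup>2)}"

definition L2_inner :: "'a::euclidean_space set \<Rightarrow> ('a \<Rightarrow> complex) \<Rightarrow> ('a \<Rightarrow> complex) \<Rightarrow> complex" where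
  "L2_inner \<Omega> f g = (LINT x|lebesgue_on \<Omega>. f x * cnj (g x))"

definition L2_norm :: "'a::euclidean_space set \<Rightarrow> ('a \<Rightarrow> complex) \<Rightarrow> real" where
  "L2_norm \<Omega> f = sqrt (LINT x|lebesgue_on \<Omega>. (cmod (f x))\<^sup>2)"


section \<open>The Laplacian\<close>

definition partial_deriv :: "'a::euclidean_space \<Rightarrow> ('a \<Rightarrow> complex) \<Rightarrow> 'a \<Rightarrow> complex" where
  "partial_deriv e f = (\<lambda>x. frechet_derivative f (at x) e)"

primrec C_k :: "nat \<Rightarrow> ('a::euclidean_space \<Rightarrow> complex) \<Rightarrow> bool" where
  "C_k 0 f \<longleftrightarrow> continuous_on UNIV f"
| "C_k (Suc k) f \<longleftrightarrow> f differentiable_on UNIV \<and> (\<forall>e\<in>Basis. C_k k (partial_deriv e f))"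

definition test_functions :: "'a::euclidean_space set \<Rightarrow> ('a \<Rightarrow> complex) set" where
  "test_functions \<Omega> = {\<phi>. (\<forall>k. C_k k \<phi>) \<and>
      compact (closure {x. \<phi> x \<noteq> 0}) \<and> closure {x. \<phi> x \<noteq> 0} \<subseteq> \<Omega>}"

definition classical_laplacian :: "('a::euclidean_space \<Rightarrow> complex) \<Rightarrow> 'a \<Rightarrow> complex" where
  "classical_laplacian \<phi> = (\<lambda>x. \<Sum>e\<in>Basis. partial_deriv e (partial_deriv e \<phi>) x)"

definition is_weak_laplacian ::
    "'a::euclidean_space set \<Rightarrow> ('a \<Rightarrow> complex) \<Rightarrow> ('a \<Rightarrow> complex) \<Rightarrow> bool" where
  "is_weak_laplacian \<Omega> v g \<longleftrightarrow> v \<in> L2 \<Omega> \<and> g \<in> L2 \<Omega> \<and>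
     (\<forall>\<phi>\<in>test_functions \<Omega>.
        (LINT x|lebesgue_on \<Omega>. v x * classical_laplacian \<phi> x)
        = (LINT x|lebesgue_on \<Omega>. g x * \<phi> x))"

text \<open>For open \<open>\<Omega>\<close> the distributional Laplacian is unique up to null sets; the choice below only
  picks a representative.\<close>

definition laplacian :: "'a::euclidean_space set \<Rightarrow> ('a \<Rightarrow> complex) \<Rightarrow> 'a \<Rightarrow> complex" where
  "laplacian \<Omega> v = (SOME g. is_weak_laplacian \<Omega> v g)"

text \<open>Boundary conditions are encoded by the operator domain \<open>\<D>\<close>: they are appropriate if the
  distributional Laplacian with domain \<open>\<D>\<close> is a self-adjoint operator on \<open>L\<^sup>2(\<Omega>)\<close>. Dirichlet,
  Neumann, Robin and periodic conditions, as well as the whole space, are of this form. The last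
  clause says that the graph of the adjoint is the graph of the operator. Since the adjoint is
  linear and blind to null sets, this forces \<open>\<D>\<close> to be a linear subspace closed under almost
  everywhere equality.\<close>

definition self_adjoint_laplacian ::
    "'a::euclidean_space set \<Rightarrow> ('a \<Rightarrow> complex) set \<Rightarrow> bool" where
  "self_adjoint_laplacian \<Omega> \<D> \<longleftrightarrow>
     test_functions \<Omega> \<subseteq> \<D> \<and>
     (\<forall>v\<in>\<D>. \<exists>g. is_weak_laplacian \<Omega> v g) \<and>
     (\<forall>w\<in>L2 \<Omega>. \<forall>f\<in>L2 \<Omega>.
        (\<forall>v\<in>\<D>. L2_inner \<Omega> (laplacian \<Omega> v) w = L2_inner \<Omega> v f)
        \<longleftrightarrow> w \<in> \<D> \<and> (AE x in lebesgue_on \<Omega>. f x = laplacian \<Omega> w x))"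


section \<open>Collocation Runge--Kutta methods\<close>

text \<open>Stages are indexed by \<open>0, \<dots>, s - 1\<close>.\<close>

definition lagrange_basis :: "nat \<Rightarrow> (nat \<Rightarrow> real) \<Rightarrow> nat \<Rightarrow> real \<Rightarrow> real" where
  "lagrange_basis s c i \<tau> = (\<Prod>j\<in>{..<s} - {i}. (\<tau> - c j) / (c i - c j))"

text \<open>The interval integral is oriented, so negative \<open>c i\<close> are covered.\<close>

definition collocation_RK ::
    "nat \<Rightarrow> (nat \<Rightarrow> nat \<Rightarrow> real) \<Rightarrow> (nat \<Rightarrow> real) \<Rightarrow> (nat \<Rightarrow> real) \<Rightarrow> bool" where
  "collocation_RK s a b c \<longleftrightarrow> inj_on c {..<s} \<and>
     (\<forall>i<s. \<forall>j<s. a i j = (LBINT \<tau>=0..ereal (c i). lagrange_basis s c j \<tau>)) \<and>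
     (\<forall>i<s. b i = (LBINT \<tau>=0..1. lagrange_basis s c i \<tau>))"

definition cooper_condition :: "nat \<Rightarrow> (nat \<Rightarrow> nat \<Rightarrow> real) \<Rightarrow> (nat \<Rightarrow> real) \<Rightarrow> bool" where
  "cooper_condition s a b \<longleftrightarrow> (\<forall>i<s. \<forall>j<s. b i * b j - b i * a i j - b j * a j i = 0)"


section \<open>The linearly implicit method\<close>

definition vandermonde :: "nat \<Rightarrow> (nat \<Rightarrow> real) \<Rightarrow> complex mat" where
  "vandermonde s c = mat s s (\<lambda>(i, j). complex_of_real (c i ^ j))"

definition first_column_mat :: "nat \<Rightarrow> complex vec \<Rightarrow> complex mat" where
  "first_column_mat s \<Theta> = mat s s (\<lambda>(i, j). if j = 0 then \<Theta> $ i else 0)"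

text \<open>The term \<open>(L + \<gamma>) v\<close> with \<open>L = \<i>\<Delta>\<close> and pointwise multiplication by \<open>\<gamma>\<close>.\<close>

definition schroedinger_op ::
    "'a::euclidean_space set \<Rightarrow> ('a \<Rightarrow> complex) \<Rightarrow> ('a \<Rightarrow> complex) \<Rightarrow> 'a \<Rightarrow> complex" where
  "schroedinger_op \<Omega> \<gamma> v = (\<lambda>x. \<i> * laplacian \<Omega> v x + \<gamma> x * v x)"

text \<open>The sequences \<open>u\<close>, \<open>\<gamma>\<close> and \<open>U\<close> (stages \<open>U k i = u\<^sub>k\<^sub>,\<^sub>i\<close>) perform the first \<open>n\<close> steps of the
  method. The time index of \<open>\<gamma>\<close> is an integer because it starts at \<open>-1\<close>. Each stage lies in the
  natural domain of the operator sum \<open>L + \<gamma>\<close>, which is the intersection of the domains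
  of \<open>L\<close> and of the multiplication by \<open>\<gamma>\<close>.\<close>

definition linearly_implicit_run ::
    "'a::euclidean_space set \<Rightarrow> ('a \<Rightarrow> complex) set \<Rightarrow> (('a \<Rightarrow> complex) \<Rightarrow> 'a \<Rightarrow> complex) \<Rightarrow>
     nat \<Rightarrow> (nat \<Rightarrow> nat \<Rightarrow> real) \<Rightarrow> (nat \<Rightarrow> real) \<Rightarrow> complex mat \<Rightarrow> complex vec \<Rightarrow> real \<Rightarrow> nat \<Rightarrow>
     (nat \<Rightarrow> 'a \<Rightarrow> complex) \<Rightarrow> (int \<Rightarrow> nat \<Rightarrow> 'a \<Rightarrow> complex) \<Rightarrow> (nat \<Rightarrow> nat \<Rightarrow> 'a \<Rightarrow> complex) \<Rightarrow> bool" where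
  "linearly_implicit_run \<Omega> \<D> N s a b D \<Theta> h n u \<gamma> U \<longleftrightarrow>
     (\<forall>k<n.
       (\<forall>i<s. AE x in lebesgue_on \<Omega>.
          \<gamma> (int k) i x = (\<Sum>j<s. D $$ (i, j) * \<gamma> (int k - 1) j x) + \<Theta> $ i * N (u k) x) \<and>
       (\<forall>i<s. U k i \<in> \<D> \<and> (\<lambda>x. \<gamma> (int k) i x * U k i x) \<in> L2 \<Omega>) \<and>
       (\<forall>i<s. AE x in lebesgue_on \<Omega>.
          U k i x = u k x + of_real h *
            (\<Sum>j<s. of_real (a i j) * schroedinger_op \<Omega> (\<gamma> (int k) j) (U k j) x)) \<and>
       (AE x in lebesgue_on \<Omega>.
          u (Suc k) x = u k x + of_real h *
            (\<Sum>i<s. of_real (b i) * schroedinger_op \<Omega> (\<gamma> (int k) i) (U k i) x)))"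

end

theory Submission
  imports Defs
begin

text \<open>Expanding \<open>\<parallel>u\<^bsub>k+1\<^esub>\<parallel>\<^sup>2\<close> and eliminating \<open>u\<^sub>k\<close> from the cross terms by means of the stage
  equations, the quadratic terms cancel by the Cooper condition. What remains is a combination of
  the terms \<open>Re \<langle>u\<^bsub>k,i\<^esub>, (L + \<gamma>\<^bsub>k,i\<^esub>) u\<^bsub>k,i\<^esub>\<rangle>\<close>. They vanish since \<open>L\<close> is skew-adjoint and
  \<open>\<gamma>\<^bsub>k,i\<^esub>\<close> is purely imaginary, which the recursion for \<open>\<Gamma>\<^sub>k\<close> preserves because \<open>D\<close>
  and \<open>\<Theta>\<close> are real.\<close>

section \<open>Norm balance of a Runge-Kutta step under the Cooper condition\<close>

text \<open>Applied below at single points of \<Omega>, with the complex numbers as a real inner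
  product space. Thus no quotient of \<open>L2\<close> by null sets has to be built, and integration
  comes last.\<close>

lemma cooper_norm_identity:
  fixes w z :: "'v::real_inner" and K V :: "nat \<Rightarrow> 'v"
  assumes cooper: "cooper_condition s a b"
    and V: "\<And>i. i < s \<Longrightarrow> V i = w + h *\<^sub>R (\<Sum>j<s. a i j *\<^sub>R K j)"
    and z: "z = w + h *\<^sub>R (\<Sum>i<s. b i *\<^sub>R K i)"
  shows "(norm z)\<^sup>2 = (norm w)\<^sup>2 + 2 * h * (\<Sum>i<s. b i * inner (V i) (K i))"
proof -
  \<comment> \<open>The squared increment contributes \<open>h * h * (2 * Q)\<close>, and trading
    \<open>w\<close> for the stages \<open>V i\<close> in the cross terms contributes
    \<open>- 2 * h * (h * Q)\<close>; the two cancel.\<close>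
  define Q where "Q = (\<Sum>i<s. \<Sum>j<s. b i * a i j * inner (K i) (K j))"
  have "(\<Sum>i<s. \<Sum>j<s. b i * b j * inner (K i) (K j)) =
      (\<Sum>i<s. \<Sum>j<s. b i * a i j * inner (K i) (K j) + b j * a j i * inner (K j) (K i))"
  proof (intro sum.cong refl)
    fix i j assume "i \<in> {..<s}" "j \<in> {..<s}"
    then have "b i * b j = b i * a i j + b j * a j i"
      using cooper by (auto simp: cooper_condition_def algebra_simps)
    then show "b i * b j * inner (K i) (K j) =
        b i * a i j * inner (K i) (K j) + b j * a j i * inner (K j) (K i)"
      by (simp add: inner_commute distrib_right)
  qed
  also have "\<dots> = Q + (\<Sum>i<s. \<Sum>j<s. b j * a j i * inner (K j) (K i))"
    by (simp add: sum.distrib Q_def)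
  also have "(\<Sum>i<s. \<Sum>j<s. b j * a j i * inner (K j) (K i)) = Q"
    unfolding Q_def by (rule sum.swap)
  finally have BB: "(\<Sum>i<s. \<Sum>j<s. b i * b j * inner (K i) (K j)) = 2 * Q"
    by simp
  have "(\<Sum>i<s. b i * inner (K i) (V i)) =
      (\<Sum>i<s. b i * inner (K i) w + h * (\<Sum>j<s. b i * a i j * inner (K i) (K j)))"
    by (intro sum.cong refl)
      (simp add: V inner_add_right inner_sum_right inner_commute sum_distrib_left distrib_left
        mult.left_commute mult.assoc)
  then have VK: "(\<Sum>i<s. b i * inner (V i) (K i)) = (\<Sum>i<s. b i * inner w (K i)) + h * Q"
    by (simp add: inner_commute sum.distrib sum_distrib_left Q_def)
  define S where "S = (\<Sum>i<s. b i *\<^sub>R K i)"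
  have wS: "inner w S = (\<Sum>i<s. b i * inner w (K i))"
    by (simp add: S_def inner_sum_right)
  have SS: "inner S S = 2 * Q"
    unfolding S_def BB[symmetric]
    by (simp add: inner_sum_left inner_sum_right sum_distrib_left inner_commute mult.left_commute
        mult.assoc)
  have "(norm z)\<^sup>2 = (norm w)\<^sup>2 + 2 * h * inner w S + h * h * inner S S"
    unfolding z S_def[symmetric] power2_norm_eq_inner
    by (simp add: inner_add_left inner_add_right inner_commute algebra_simps)
  then show ?thesis
    by (simp add: wS SS VK algebra_simps)
qed

section \<open>Almost everywhere equality and \<open>L2\<close> pairings\<close>

lemma complete_measure_lebesgue_on:
  assumes "\<Omega> \<in> sets lebesgue"
  shows "complete_measure (lebesgue_on \<Omega>)"
proof
  fix A B assume "B \<subseteq> A" "A \<in> null_sets (lebesgue_on \<Omega>)"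
  then show "B \<in> sets (lebesgue_on \<Omega>)"
    using assms completion.complete2[of B A lborel]
    by (auto simp: null_sets_restrict_space sets_restrict_space_iff)
qed

text \<open>Preimages under \<open>f\<close> and \<open>g\<close> differ by a null set, which
  completeness makes harmless. The condition on \<open>g\<close> is separate because the equality
  says nothing on the exceptional set.\<close>

lemma (in complete_measure) measurable_AE_eq:
  assumes f: "f \<in> measurable M N"
    and eq: "AE x in M. g x = f x"
    and g: "g \<in> space M \<rightarrow> space N"
  shows "g \<in> measurable M N"
proof (rule measurableI)
  fix A assume "A \<in> sets N"
  then have "f -` A \<inter> space M \<in> sets M"
    using f by (rule measurable_sets[rotated])
  moreover have "AE x in M. x \<in> f -` A \<inter> space M \<longleftrightarrow> x \<in> g -` A \<inter> space M"
    using eq by eventually_elim auto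
  ultimately show "g -` A \<inter> space M \<in> sets M"
    using in_sets_AE[of "f -` A \<inter> space M" "g -` A \<inter> space M"] by simp
qed (use g in auto)

text \<open>The product is dominated by the sum of the two squared moduli, which is
  integrable.\<close>

lemma integrable_L2_mult_cnj:
  assumes "f \<in> L2 \<Omega>" "g \<in> L2 \<Omega>"
  shows "integrable (lebesgue_on \<Omega>) (\<lambda>x. f x * cnj (g x))"
proof (rule Bochner_Integration.integrable_bound)
  show "integrable (lebesgue_on \<Omega>) (\<lambda>x. (cmod (f x))\<^sup>2 + (cmod (g x))\<^sup>2)"
    using assms by (auto simp: L2_def)
  show "(\<lambda>x. f x * cnj (g x)) \<in> borel_measurable (lebesgue_on \<Omega>)"
    using assms by (auto simp: L2_def intro!: borel_measurable_times
        measurable_compose[OF _ borel_measurable_continuous_onI[of cnj]] continuous_intros)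
  have "cmod z * cmod w \<le> (cmod z)\<^sup>2 + (cmod w)\<^sup>2" for z w
  proof -
    have "0 \<le> cmod z * cmod w"
      by simp
    then show ?thesis
      using sum_squares_bound[of "cmod z" "cmod w"] unfolding mult.assoc by linarith
  qed
  then show "AE x in lebesgue_on \<Omega>. norm (f x * cnj (g x)) \<le> norm ((cmod (f x))\<^sup>2 + (cmod (g x))\<^sup>2)"
    by (simp add: norm_mult)
qed

lemma L2_inner_commute: "L2_inner \<Omega> g f = cnj (L2_inner \<Omega> f g)"
  by (simp add: L2_inner_def mult.commute flip: Bochner_Integration.integral_cnj)

section \<open>Symmetry of the Laplacian and conservation over one step\<close>

context
  fixes \<Omega> :: "'a::euclidean_space set" and \<D> :: "('a \<Rightarrow> complex) set"
  assumes sa: "self_adjoint_laplacian \<Omega> \<D>"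
begin

text \<open>Membership in \<D> guarantees a witness for the choice operator behind
  \<open>laplacian\<close>.\<close>

lemma is_weak_laplacian_laplacian:
  assumes "v \<in> \<D>"
  shows "is_weak_laplacian \<Omega> v (laplacian \<Omega> v)"
  using sa assms unfolding laplacian_def self_adjoint_laplacian_def by (metis someI_ex)

lemma domain_in_L2: "v \<in> \<D> \<Longrightarrow> v \<in> L2 \<Omega>"
  and laplacian_in_L2: "v \<in> \<D> \<Longrightarrow> laplacian \<Omega> v \<in> L2 \<Omega>"
  using is_weak_laplacian_laplacian by (auto simp: is_weak_laplacian_def)

lemma Im_L2_inner_laplacian:
  assumes "v \<in> \<D>"
  shows "Im (L2_inner \<Omega> v (laplacian \<Omega> v)) = 0"
proof -
  \<comment> \<open>In the graph condition take both \<open>w\<close> and \<open>v\<close> to be the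
    given function and \<open>f\<close> its Laplacian; the right side of the equivalence is then
    immediate.\<close>
  have "L2_inner \<Omega> (laplacian \<Omega> v) v = L2_inner \<Omega> v (laplacian \<Omega> v)"
    using sa assms domain_in_L2 laplacian_in_L2 unfolding self_adjoint_laplacian_def by blast
  then have "cnj (L2_inner \<Omega> v (laplacian \<Omega> v)) = L2_inner \<Omega> v (laplacian \<Omega> v)"
    by (metis L2_inner_commute)
  then show ?thesis
    by (simp add: complex_eq_iff)
qed

text \<open>Membership of \<open>u'\<close> in \<open>L2\<close> is concluded as well, so that the
  step can be iterated.\<close>

lemma linearly_implicit_step_L2_norm:
  fixes \<gamma> U :: "nat \<Rightarrow> 'a \<Rightarrow> complex" and u u' :: "'a \<Rightarrow> complex"
  defines "K \<equiv> \<lambda>i. schroedinger_op \<Omega> (\<gamma> i) (U i)"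
  assumes \<Omega>: "\<Omega> \<in> sets lebesgue"
    and cooper: "cooper_condition s a b"
    and imag: "\<And>i. i < s \<Longrightarrow> AE x in lebesgue_on \<Omega>. Re (\<gamma> i x) = 0"
    and u: "u \<in> L2 \<Omega>"
    and U: "\<And>i. i < s \<Longrightarrow> U i \<in> \<D>"
    and \<gamma>U: "\<And>i. i < s \<Longrightarrow> (\<lambda>x. \<gamma> i x * U i x) \<in> L2 \<Omega>"
    and stages: "\<And>i. i < s \<Longrightarrow> AE x in lebesgue_on \<Omega>.
          U i x = u x + of_real h * (\<Sum>j<s. of_real (a i j) * K j x)"
    and update: "AE x in lebesgue_on \<Omega>. u' x = u x + of_real h * (\<Sum>i<s. of_real (b i) * K i x)"
  shows "u' \<in> L2 \<Omega>" and "L2_norm \<Omega> u' = L2_norm \<Omega> u"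
proof -
  interpret complete_measure "lebesgue_on \<Omega>"
    using \<Omega> by (rule complete_measure_lebesgue_on)
  define p where "p = (\<lambda>i x. U i x * cnj (laplacian \<Omega> (U i) x))"
  \<comment> \<open>The pointwise value of |u'|^2 predicted by the Cooper identity. Being written in
    terms of \<open>u\<close> and \<open>p\<close>, it is integrable before anything is known about
    \<open>u'\<close>.\<close>
  define r where "r = (\<lambda>x. (cmod (u x))\<^sup>2 + 2 * h * (\<Sum>i<s. b i * Im (p i x)))"
  have p_int: "integrable (lebesgue_on \<Omega>) (p i)" if "i < s" for i
    unfolding p_def using U[OF that] by (intro integrable_L2_mult_cnj domain_in_L2 laplacian_in_L2)
  have u_int: "integrable (lebesgue_on \<Omega>) (\<lambda>x. (cmod (u x))\<^sup>2)"
    using u by (simp add: L2_def)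
  have Im_int: "integrable (lebesgue_on \<Omega>) (\<lambda>x. b i * Im (p i x))" if "i < s" for i
    using integrable_Im[OF p_int[OF that]] by (rule integrable_mult_right)
  have sum_int: "integrable (lebesgue_on \<Omega>) (\<lambda>x. 2 * h * (\<Sum>i<s. b i * Im (p i x)))"
    by (rule integrable_mult_right, rule Bochner_Integration.integrable_sum) (rule Im_int, simp)
  have r_int: "integrable (lebesgue_on \<Omega>) r"
    unfolding r_def using u_int sum_int by (rule Bochner_Integration.integrable_add)
  \<comment> \<open>The Laplacian term cancels through integration, by symmetry, whereas the
    \<gamma> term vanishes pointwise.\<close>
  have Im_p: "(LINT x|lebesgue_on \<Omega>. Im (p i x)) = 0" if "i < s" for i
    using Im_L2_inner_laplacian[OF U[OF that]] integral_Im[OF p_int[OF that]]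
    by (simp only: L2_inner_def p_def)
  have r_integral: "(LINT x|lebesgue_on \<Omega>. r x) = (LINT x|lebesgue_on \<Omega>. (cmod (u x))\<^sup>2)"
  proof -
    have "(LINT x|lebesgue_on \<Omega>. (\<Sum>i<s. b i * Im (p i x))) =
        (\<Sum>i<s. (LINT x|lebesgue_on \<Omega>. b i * Im (p i x)))"
      by (rule Bochner_Integration.integral_sum) (rule Im_int, simp)
    also have "\<dots> = 0"
      using Im_p by simp
    finally show ?thesis
      unfolding r_def Bochner_Integration.integral_add[OF u_int sum_int] by simp
  qed
  \<comment> \<open>The product of \<gamma> and the stage is treated as one function: it lies in
    \<open>L2\<close>, while nothing is assumed on the measurability of \<gamma> alone.\<close>
  have K_meas: "K i \<in> borel_measurable (lebesgue_on \<Omega>)" if "i < s" for i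
  proof -
    have "laplacian \<Omega> (U i) \<in> borel_measurable (lebesgue_on \<Omega>)"
      "(\<lambda>x. \<gamma> i x * U i x) \<in> borel_measurable (lebesgue_on \<Omega>)"
      using laplacian_in_L2[OF U[OF that]] \<gamma>U[OF that] by (simp_all add: L2_def)
    then show ?thesis
      unfolding K_def schroedinger_op_def
      by (intro borel_measurable_add borel_measurable_times[OF borel_measurable_const])
  qed
  have "(\<lambda>x. u x + of_real h * (\<Sum>i<s. of_real (b i) * K i x)) \<in> borel_measurable (lebesgue_on \<Omega>)"
  proof (rule borel_measurable_add)
    show "u \<in> borel_measurable (lebesgue_on \<Omega>)"
      using u by (simp add: L2_def)
    show "(\<lambda>x. of_real h * (\<Sum>i<s. of_real (b i) * K i x)) \<in> borel_measurable (lebesgue_on \<Omega>)"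
      by (intro borel_measurable_times[OF borel_measurable_const] borel_measurable_sum K_meas) simp
  qed
  \<comment> \<open>The update determines \<open>u'\<close> only almost everywhere, so completeness
    of the measure enters here.\<close>
  then have u'_meas [measurable]: "u' \<in> borel_measurable (lebesgue_on \<Omega>)"
    using update by (rule measurable_AE_eq) simp
  have imag_all: "AE x in lebesgue_on \<Omega>. \<forall>i\<in>{..<s}. Re (\<gamma> i x) = 0"
    using imag by (intro AE_finite_allI) auto
  have stages_all: "AE x in lebesgue_on \<Omega>. \<forall>i\<in>{..<s}.
      U i x = u x + of_real h * (\<Sum>j<s. of_real (a i j) * K j x)"
    using stages by (intro AE_finite_allI) auto
  have norm_eq: "AE x in lebesgue_on \<Omega>. r x = (cmod (u' x))\<^sup>2"
    using imag_all stages_all update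
  proof eventually_elim
    case (elim x)
    \<comment> \<open>The real inner product of z and w is Re (z * cnj w). The factor
      \<open>\<i>\<close> before the Laplacian turns this real part into \<open>Im (p i x)\<close>,
      and \<gamma> adds Re \<gamma> times |U|^2, which is zero.\<close>
    have "inner (U i x) (K i x) = Im (p i x)" if "i < s" for i
    proof -
      have "Re (\<gamma> i x) = 0"
        using elim(1) that by simp
      then show ?thesis
        by (simp add: K_def p_def schroedinger_op_def inner_complex_def algebra_simps)
    qed
    moreover have "(cmod (u' x))\<^sup>2 =
        (cmod (u x))\<^sup>2 + 2 * h * (\<Sum>i<s. b i * inner (U i x) (K i x))"
    proof (rule cooper_norm_identity[OF cooper])
      show "U i x = u x + h *\<^sub>R (\<Sum>j<s. a i j *\<^sub>R K j x)" if "i < s" for i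
        unfolding scaleR_conv_of_real using elim(2) that by blast
      show "u' x = u x + h *\<^sub>R (\<Sum>i<s. b i *\<^sub>R K i x)"
        unfolding scaleR_conv_of_real using elim(3) .
    qed
    ultimately show ?case
      by (simp add: r_def)
  qed
  have u'_int: "integrable (lebesgue_on \<Omega>) (\<lambda>x. (cmod (u' x))\<^sup>2)"
    by (rule integrable_cong_AE_imp[OF r_int _ norm_eq]) simp
  then show "u' \<in> L2 \<Omega>"
    by (simp add: L2_def)
  have "(LINT x|lebesgue_on \<Omega>. r x) = (LINT x|lebesgue_on \<Omega>. (cmod (u' x))\<^sup>2)"
    using r_int norm_eq by (intro integral_cong_AE) auto
  with r_integral show "L2_norm \<Omega> u' = L2_norm \<Omega> u"
    by (simp add: L2_norm_def)
qed

end

section \<open>Induction over the time steps\<close>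

theorem proposition4p1:
  fixes \<Omega> :: "'a::euclidean_space set"
    and \<D> :: "('a \<Rightarrow> complex) set"
    and N :: "('a \<Rightarrow> complex) \<Rightarrow> 'a \<Rightarrow> complex"
    and s n :: nat
    and a :: "nat \<Rightarrow> nat \<Rightarrow> real" and b c :: "nat \<Rightarrow> real"
    and D :: "complex mat" and \<Theta> :: "complex vec"
    and h :: real
    and u :: "nat \<Rightarrow> 'a \<Rightarrow> complex"
    and \<gamma> :: "int \<Rightarrow> nat \<Rightarrow> 'a \<Rightarrow> complex"
    and U :: "nat \<Rightarrow> nat \<Rightarrow> 'a \<Rightarrow> complex"
  assumes "open \<Omega>"
    and "self_adjoint_laplacian \<Omega> \<D>"
    and N_imaginary: "\<And>v. v \<in> L2 \<Omega> \<Longrightarrow> AE x in lebesgue_on \<Omega>. Re (N v x) = 0"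
    and "h > 0" and "s \<ge> 1"
    and "collocation_RK s a b c"
    and "cooper_condition s a b"
    and "D \<in> carrier_mat s s" and "\<Theta> \<in> carrier_vec s"
    and "spectral_radius D < 1"
    and "vandermonde s c = D * vandermonde s (\<lambda>i. c i - 1) + first_column_mat s \<Theta>"
    and D_real: "\<And>i j. i < s \<Longrightarrow> j < s \<Longrightarrow> D $$ (i, j) \<in> \<real>"
    and \<Theta>_real: "\<And>i. i < s \<Longrightarrow> \<Theta> $ i \<in> \<real>"
    and \<gamma>_imaginary: "\<And>i. i < s \<Longrightarrow> AE x in lebesgue_on \<Omega>. Re (\<gamma> (-1) i x) = 0"
    and "u 0 \<in> L2 \<Omega>"
    and "linearly_implicit_run \<Omega> \<D> N s a b D \<Theta> h n u \<gamma> U"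
  shows "(L2_norm \<Omega> (u n))\<^sup>2 = (L2_norm \<Omega> (u 0))\<^sup>2"
proof -
  note run = assms(16)[unfolded linearly_implicit_run_def, rule_format]
  have \<Omega>: "\<Omega> \<in> sets lebesgue"
    using \<open>open \<Omega>\<close> by simp
  \<comment> \<open>The invariant carries \<open>L2\<close> membership because
    \<open>N_imaginary\<close> requires it. The shifted index \<open>int k - 1\<close> makes the
    case \<open>k = 0\<close> the hypothesis on the initial \<gamma>.\<close>
  have "u k \<in> L2 \<Omega> \<and> L2_norm \<Omega> (u k) = L2_norm \<Omega> (u 0) \<and>
      (\<forall>i<s. AE x in lebesgue_on \<Omega>. Re (\<gamma> (int k - 1) i x) = 0)" if "k \<le> n" for k
    using that
  proof (induction k)
    case 0
    then show ?case
      using \<open>u 0 \<in> L2 \<Omega>\<close> \<gamma>_imaginary by simp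
  next
    case (Suc k)
    then have k: "k < n" and u: "u k \<in> L2 \<Omega>" and norm_u: "L2_norm \<Omega> (u k) = L2_norm \<Omega> (u 0)"
      and \<gamma>: "\<And>i. i < s \<Longrightarrow> AE x in lebesgue_on \<Omega>. Re (\<gamma> (int k - 1) i x) = 0"
      by auto
    have \<gamma>_all: "AE x in lebesgue_on \<Omega>. \<forall>j\<in>{..<s}. Re (\<gamma> (int k - 1) j x) = 0"
      using \<gamma> by (intro AE_finite_allI) auto
    have imag: "AE x in lebesgue_on \<Omega>. Re (\<gamma> (int k) i x) = 0" if i: "i < s" for i
    proof -
      have rec: "AE x in lebesgue_on \<Omega>.
          \<gamma> (int k) i x = (\<Sum>j<s. D $$ (i, j) * \<gamma> (int k - 1) j x) + \<Theta> $ i * N (u k) x"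
        using run[OF k] i by blast
      show ?thesis
        using rec \<gamma>_all N_imaginary[OF u]
      proof eventually_elim
        case (elim x)
        have "Im (D $$ (i, j)) = 0" if "j < s" for j
          using D_real[OF i that] by (simp add: complex_is_Real_iff)
        moreover have "Im (\<Theta> $ i) = 0"
          using \<Theta>_real[OF i] by (simp add: complex_is_Real_iff)
        ultimately show ?case
          using elim by simp
      qed
    qed
    have stage: "U k i \<in> \<D>" "(\<lambda>x. \<gamma> (int k) i x * U k i x) \<in> L2 \<Omega>"
      "AE x in lebesgue_on \<Omega>. U k i x = u k x + of_real h *
        (\<Sum>j<s. of_real (a i j) * schroedinger_op \<Omega> (\<gamma> (int k) j) (U k j) x)" if "i < s" for i
      using run[OF k] that by blast+
    have update: "AE x in lebesgue_on \<Omega>. u (Suc k) x = u k x + of_real h *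
        (\<Sum>i<s. of_real (b i) * schroedinger_op \<Omega> (\<gamma> (int k) i) (U k i) x)"
      using run[OF k] by blast
    note step = linearly_implicit_step_L2_norm[where \<gamma> = "\<gamma> (int k)" and U = "U k" and u = "u k"
        and u' = "u (Suc k)" and a = a and b = b and h = h,
        OF \<open>self_adjoint_laplacian \<Omega> \<D>\<close> \<Omega> \<open>cooper_condition s a b\<close> imag u stage update]
    \<comment> \<open>Since \<open>int (Suc k) - 1 = int k\<close>, the fact \<open>imag\<close>
      serves both in \<open>step\<close> and as the last component of the new invariant.\<close>
    show ?case
      using step imag norm_u by simp
  qed
  from this[OF order_refl] show ?thesis
    by simp
qed

end
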